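(* Let $Z$ be a (real) locally convex space and $C \subseteq Z$ a convex cone with $0 \in C$ and $Z \neq \operatorname{cl} C$. Let $\mathcal F(Z,C) = \{A \subseteq Z \mid A = \operatorname{cl}(A+C)\}$. Then the relation $\supseteq$ is total on $\mathcal F(Z, C)$ (that is, for all $A, B \in \mathcal F(Z,C)$ one has $A \supseteq B$ or $B \supseteq A$) if, and only if, $\operatorname{cl} C$ coincides with a half-space $H^+(z^* ) := \{z \in Z \mid z^*(z) \geq 0\}$ for some $z^* \in C^+\setminus\{0\}$.
   Context: A set $C$ is a cone if $z \in C$, $t>0$ imply $tz \in C$. $A + B$ is Minkowski addition with $A + \emptyset = \emptyset$, so $\emptyset \in \mathcal F(Z,C)$. $Z^*$ is the topological dual of $Z$ and $C^+ = \{z^* \in Z^* \mid \forall z \in C\colon z^*(z) \geq 0\}$. *)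

theory Defs
  imports "HOL-Analysis.Analysis"
begin

(* Real locally convex spaces; the Hausdorff property is not part of the definition.
   The second axiom spells out convexity and interior because the constants convex and
   interior cannot be used inside a class specification; see convex_nhds_zero_base. *)
class locally_convex_space = real_vector + topological_group_add +
  assumes tendsto_scaleR_nhds_Pair:
    "LIM p (nhds (t :: real) \<times>\<^sub>F nhds z). fst p *\<^sub>R snd p :> nhds (t *\<^sub>R z)"
  and convex_nhds_zero_base_raw:
    "open U \<Longrightarrow> 0 \<in> U \<Longrightarrow>
      \<exists>V. (\<forall>x\<in>V. \<forall>y\<in>V. \<forall>u\<ge>0. \<forall>v\<ge>0. u + v = 1 \<longrightarrow> u *\<^sub>R x + v *\<^sub>R y \<in> V)
        \<and> (\<exists>W. open W \<and> 0 \<in> W \<and> W \<subseteq> V) \<and> V \<subseteq> U"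

lemma convex_nhds_zero_base:
  fixes U :: "'a::locally_convex_space set"
  assumes "open U" "0 \<in> U"
  shows "\<exists>V. convex V \<and> 0 \<in> interior V \<and> V \<subseteq> U"
  using convex_nhds_zero_base_raw[OF assms] unfolding convex_def interior_def by blast

instance real_normed_vector \<subseteq> locally_convex_space
proof
  fix t :: real and z :: 'a
  show "LIM p (nhds t \<times>\<^sub>F nhds z). fst p *\<^sub>R snd p :> nhds (t *\<^sub>R z)"
    by (intro tendsto_scaleR filterlim_fst filterlim_snd)
next
  fix U :: "'a set"
  assume "open U" "0 \<in> U"
  then obtain e where "e > 0" "ball 0 e \<subseteq> U"
    by (meson openE)
  moreover have "convex (ball (0::'a) e)" by simp
  ultimately show "\<exists>V. (\<forall>x\<in>V. \<forall>y\<in>V. \<forall>u\<ge>0. \<forall>v\<ge>0. u + v = 1 \<longrightarrow> u *\<^sub>R x + v *\<^sub>R y \<in> V)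
      \<and> (\<exists>W. open W \<and> 0 \<in> W \<and> W \<subseteq> V) \<and> V \<subseteq> U"
    unfolding convex_def by (intro exI[of _ "ball 0 e"] conjI) auto
qed

(* Unlike the library's cone, scalars are strictly positive, so 0 need not belong to
   a nonempty cone. *)
definition positive_cone :: "'a::real_vector set \<Rightarrow> bool" where
  "positive_cone C \<longleftrightarrow> (\<forall>z\<in>C. \<forall>t>0. t *\<^sub>R z \<in> C)"

definition topological_dual :: "('a::{real_vector,topological_space} \<Rightarrow> real) set" where
  "topological_dual = {f. linear f \<and> continuous_on UNIV f}"

definition dual_cone :: "'a::{real_vector,topological_space} set \<Rightarrow> ('a \<Rightarrow> real) set" where
  "dual_cone C = {f \<in> topological_dual. \<forall>z\<in>C. f z \<ge> 0}"

definition halfspace :: "('a \<Rightarrow> real) \<Rightarrow> 'a set" where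
  "halfspace f = {z. f z \<ge> 0}"

(* The sum is the Minkowski sum of HOL-Library.Set_Algebras, for which {} + C = {}. *)
definition closed_upper_sets :: "'a::{topological_space,plus} set \<Rightarrow> 'a set set" where
  "closed_upper_sets C = {A. A = closure (A + C)}"

end

(* Totality applied to the translates of K = cl C gives K \<union> -K = Z. Fix e in K outside -K. For
   each x the closed sets {t. x - t e \<in> K} and {t. t e - x \<in> K} are nonempty and cover the real
   line, so by connectedness they share a point f x; it is unique, hence linear in x, and
   x \<in> K iff f x \<ge> 0.
   Conversely, a set that absorbs the half-space of f is the preimage of an up-set of reals, and
   up-sets of reals form a chain. *)

theory Submission
  imports Defs
begin

text \<open>The class axiom is joint continuity of scaling at a single pair; composing it with the
  two limits gives a form usable along any filter.\<close>

lemma tendsto_scaleR_locally_convex: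
  fixes g :: "'b \<Rightarrow> 'a::locally_convex_space"
  assumes "(f \<longlongrightarrow> t) F" "(g \<longlongrightarrow> z) F"
  shows "((\<lambda>x. f x *\<^sub>R g x) \<longlongrightarrow> t *\<^sub>R z) F"
  using filterlim_compose[OF tendsto_scaleR_nhds_Pair filterlim_Pair[OF assms]] by simp

lemma continuous_on_scaleR_locally_convex:
  fixes g :: "'b::topological_space \<Rightarrow> 'a::locally_convex_space"
  assumes "continuous_on S f" "continuous_on S g"
  shows "continuous_on S (\<lambda>x. f x *\<^sub>R g x)"
  using assms unfolding continuous_on_def by (blast intro: tendsto_scaleR_locally_convex)

text \<open>Complements of closed level sets are open rays' preimages, and open rays generate the
  order topology. This reduces continuity of the functional to closedness of
  \<open>K\<close>.\<close>

lemma continuous_on_if_closed_levels: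
  fixes f :: "'a::topological_space \<Rightarrow> 'b::linorder_topology"
  assumes "\<And>a. closed {x. f x \<ge> a}" "\<And>a. closed {x. f x \<le> a}"
  shows "continuous_on UNIV f"
proof -
  have "open {x. f x < a}" "open {x. f x > a}" for a
    using assms[of a] by (simp_all add: closed_def Collect_neg_eq[symmetric] not_le)
  then show ?thesis
    unfolding continuous_on_def
    by (intro ballI order_tendstoI; unfold eventually_at_topological; blast)
qed

text \<open>One summand at a time: with the other fixed, the preimage of \<open>S\<close> under a
  translation is closed, so it contains the closure of whatever it contains.\<close>

lemma closure_add_subset:
  fixes A B S :: "'a::topological_group_add set"
  assumes "closed S" "A + B \<subseteq> S"
  shows "closure A + closure B \<subseteq> S"
proof -
  have 1: "a + y \<in> S" if "a \<in> A" "y \<in> closure B" for a y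
  proof -
    have "closed ((\<lambda>y. a + y) -` S)"
      by (intro closed_vimage assms continuous_intros)
    moreover have "B \<subseteq> (\<lambda>y. a + y) -` S"
      using assms(2) \<open>a \<in> A\<close> by (auto simp: set_plus_def)
    ultimately show ?thesis
      using closure_minimal \<open>y \<in> closure B\<close> by blast
  qed
  have "x + y \<in> S" if "x \<in> closure A" "y \<in> closure B" for x y
  proof -
    have "closed ((\<lambda>x. x + y) -` S)"
      by (intro closed_vimage assms continuous_intros)
    moreover have "A \<subseteq> (\<lambda>x. x + y) -` S"
      using 1 that(2) by auto
    ultimately show ?thesis
      using closure_minimal that(1) by blast
  qed
  then show ?thesis
    by (auto simp: set_plus_def)
qed

lemma positive_cone_closure:
  fixes C :: "'a::locally_convex_space set"
  assumes "positive_cone C"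
  shows "positive_cone (closure C)"
  unfolding positive_cone_def
proof (intro ballI allI impI)
  fix z and t :: real
  assume z: "z \<in> closure C" and "t > 0"
  have "closed ((\<lambda>y. t *\<^sub>R y) -` closure C)"
    by (intro closed_vimage continuous_on_scaleR_locally_convex continuous_intros) simp
  moreover have "C \<subseteq> (\<lambda>y. t *\<^sub>R y) -` closure C"
    using assms \<open>t > 0\<close> closure_subset[of C] unfolding positive_cone_def by blast
  ultimately show "t *\<^sub>R z \<in> closure C"
    using closure_minimal z by blast
qed

text \<open>A sum is twice the midpoint.\<close>

lemma convex_positive_cone_add_subset:
  assumes "convex C" "positive_cone C"
  shows "C + C \<subseteq> C"
proof -
  have "x + y \<in> C" if "x \<in> C" "y \<in> C" for x y
  proof -
    have "(1/2) *\<^sub>R x + (1/2) *\<^sub>R y \<in> C"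
      using convexD[OF \<open>convex C\<close> that, of "1/2" "1/2"] by simp
    then have "2 *\<^sub>R ((1/2) *\<^sub>R x + (1/2) *\<^sub>R y) \<in> C"
      using assms(2) unfolding positive_cone_def by (meson zero_less_numeral)
    then show ?thesis
      by (simp add: scaleR_add_right)
  qed
  then show ?thesis
    by (auto simp: set_plus_def)
qed

text \<open>Since \<open>0 \<in> C\<close> gives \<open>A \<subseteq> A + C\<close>, the fixed-point
  equation splits into closedness and absorption. Absorbing \<open>C\<close> extends to
  \<open>closure C\<close> because \<open>A\<close> is closed, so only \<open>closure C\<close>
  matters from here on.\<close>

lemma closed_upper_sets_iff:
  fixes A C :: "'a::topological_group_add set"
  assumes "0 \<in> C"
  shows "A \<in> closed_upper_sets C \<longleftrightarrow> closed A \<and> A + closure C \<subseteq> A"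
proof
  assume "A \<in> closed_upper_sets C"
  then have A: "A = closure (A + C)"
    by (simp add: closed_upper_sets_def)
  then have "closed A"
    by (metis closed_closure)
  moreover have "A + C \<subseteq> A"
    using A closure_subset by blast
  ultimately show "closed A \<and> A + closure C \<subseteq> A"
    using closure_add_subset[of A A C] by simp
next
  assume A: "closed A \<and> A + closure C \<subseteq> A"
  have "A + C \<subseteq> A"
    using A set_plus_mono2[OF subset_refl closure_subset, of A C] by blast
  moreover have "A \<subseteq> A + C"
    using assms by (metis add.right_neutral set_plus_intro subsetI)
  ultimately show "A \<in> closed_upper_sets C"
    using A by (simp add: closed_upper_sets_def subset_antisym)
qed

text \<open>The functional is built directly, without a separation theorem, as the coordinate along
  \<open>e\<close> modulo the lineality space of \<open>K\<close>.\<close>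

lemma closed_total_cone_is_halfspace:
  fixes K :: "'a::locally_convex_space set"
  assumes closed: "closed K" and cone: "positive_cone K" and add: "K + K \<subseteq> K"
    and total: "\<And>x. x \<in> K \<or> - x \<in> K" and "K \<noteq> UNIV"
  obtains f where "linear f" "continuous_on UNIV f" "f \<noteq> (\<lambda>_. 0)" "K = halfspace f"
proof -
  have K0: "0 \<in> K"
    using total[of 0] by simp
  have Kadd: "x + y \<in> K" if "x \<in> K" "y \<in> K" for x y
    using add that by (auto simp: set_plus_def)
  have Kscale: "t *\<^sub>R x \<in> K" if "x \<in> K" "t \<ge> 0" for x t
    using cone that K0 by (cases "t = 0") (auto simp: positive_cone_def)
  \<comment> \<open>If \<open>K\<close> were symmetric, totality would force it to be the whole
    space.\<close>
  obtain e where e: "e \<in> K" "- e \<notin> K"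
    using \<open>K \<noteq> UNIV\<close> total by (metis UNIV_eq_I minus_minus)
  \<comment> \<open>The lineality space of \<open>K\<close>, which will be the kernel of
    \<open>f\<close>.\<close>
  define L where "L = K \<inter> uminus -` K"
  have L: "subspace L"
  proof (rule subspaceI)
    show "0 \<in> L"
      using K0 by (simp add: L_def)
    show "x + y \<in> L" if "x \<in> L" "y \<in> L" for x y
      using that Kadd Kadd[of "-x" "-y"] by (simp add: L_def add.commute)
    show "c *\<^sub>R x \<in> L" if "x \<in> L" for c x
      using that Kscale[of x c] Kscale[of "-x" c] Kscale[of x "-c"] Kscale[of "-x" "-c"]
      by (cases "c \<ge> 0") (simp_all add: L_def)
  qed
  have neg_mult_e: "t *\<^sub>R e \<notin> K" if "t < 0" for t
  proof
    assume "t *\<^sub>R e \<in> K"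
    \<comment> \<open>The factor is positive because \<open>t < 0\<close>, and the product is
      \<open>- e\<close>.\<close>
    then have "(- 1 / t) *\<^sub>R t *\<^sub>R e \<in> K"
      by (rule Kscale) (use that in \<open>simp add: divide_nonpos_neg\<close>)
    then show False
      using that e(2) by simp
  qed
  \<comment> \<open>For small \<open>s > 0\<close> the point \<open>s x - e\<close> is close to
    \<open>- e\<close>, hence in the open complement of \<open>K\<close>. Dividing by
    \<open>s\<close> shows that \<open>t = 1/s\<close> works.\<close>
  have line_leaves_K: "\<exists>t. x - t *\<^sub>R e \<notin> K" for x
  proof -
    have "((\<lambda>s. s *\<^sub>R x - e) \<longlongrightarrow> 0 *\<^sub>R x - e) (at_right 0)"
      by (intro tendsto_diff tendsto_scaleR_locally_convex tendsto_ident_at tendsto_const)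
    then have "((\<lambda>s. s *\<^sub>R x - e) \<longlongrightarrow> - e) (at_right 0)"
      by simp
    moreover have "open (- K)" "- e \<in> - K"
      using closed e by auto
    ultimately have "\<forall>\<^sub>F s in at_right 0. s *\<^sub>R x - e \<in> - K"
      by (rule topological_tendstoD)
    moreover have "\<forall>\<^sub>F s in at_right (0::real). s > 0"
      by (rule eventually_at_right_less)
    ultimately have "\<forall>\<^sub>F s in at_right 0. s *\<^sub>R x - e \<in> - K \<and> s > 0"
      by (rule eventually_conj)
    then obtain s where s: "s *\<^sub>R x - e \<notin> K" "s > 0"
      using eventually_happens[of _ "at_right (0::real)"] by auto
    have "s *\<^sub>R (x - (1/s) *\<^sub>R e) = s *\<^sub>R x - e"
      using s(2) by (simp add: scaleR_diff_right)
    then show ?thesis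
      using s Kscale by (metis less_imp_le)
  qed
  have "\<exists>t. x - t *\<^sub>R e \<in> L" for x
  proof -
    define S where "S = (\<lambda>t. x - t *\<^sub>R e) -` K"
    define T where "T = (\<lambda>t. t *\<^sub>R e - x) -` K"
    have "closed S" "closed T"
      unfolding S_def T_def
      by (intro closed_vimage closed continuous_on_scaleR_locally_convex continuous_intros)+
    moreover have cover: "t \<in> S \<or> t \<in> T" for t
      using total[of "x - t *\<^sub>R e"] by (simp add: S_def T_def)
    moreover have "T \<noteq> {}"
      using line_leaves_K[of x] cover by (auto simp: S_def)
    \<comment> \<open>Reflection of the previous case: the line through \<open>- x\<close> leaves
      \<open>K\<close>, so by totality \<open>x + t e\<close> lies in \<open>K\<close> for some
      \<open>t\<close>.\<close>
    moreover have "S \<noteq> {}"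
    proof -
      obtain t where "- x - t *\<^sub>R e \<notin> K"
        using line_leaves_K by blast
      then have "- t \<in> S"
        using total[of "- x - t *\<^sub>R e"] by (simp add: S_def add.commute)
      then show ?thesis by blast
    qed
    \<comment> \<open>The real line is not a union of two disjoint nonempty closed sets. A common
      \<open>t\<close> puts both \<open>x - t e\<close> and its negative in
      \<open>K\<close>.\<close>
    ultimately have "S \<inter> T \<noteq> {}"
      using connected_UNIV[where 'a=real, unfolded connected_closed] by blast
    then show ?thesis
      by (auto simp: S_def T_def L_def)
  qed
  then obtain f where f: "x - f x *\<^sub>R e \<in> L" for x
    by metis
  \<comment> \<open>Two distinct values would put a nonzero multiple of \<open>e\<close> into
    \<open>L\<close>, hence a negative multiple of \<open>e\<close> into \<open>K\<close>. Linearity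
    follows by checking that the expected value is admissible.\<close>
  have f_unique: "f x = t" if "x - t *\<^sub>R e \<in> L" for x t
  proof (rule ccontr)
    assume "f x \<noteq> t"
    have "(x - t *\<^sub>R e) - (x - f x *\<^sub>R e) \<in> L"
      using L that f subspace_diff by blast
    then have "(f x - t) *\<^sub>R e \<in> L"
      by (simp add: scaleR_diff_left)
    then have "(f x - t) *\<^sub>R e \<in> K" "(t - f x) *\<^sub>R e \<in> K"
      by (auto simp: L_def scaleR_diff_left)
    then show False
      using neg_mult_e[of "f x - t"] neg_mult_e[of "t - f x"] \<open>f x \<noteq> t\<close> by linarith
  qed
  have "linear f"
  proof (rule linearI)
    fix x y
    show "f (x + y) = f x + f y"
      using subspace_add[OF L f[of x] f[of y]]
      by (intro f_unique) (simp add: scaleR_add_left algebra_simps)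
  next
    fix c x
    show "f (c *\<^sub>R x) = c *\<^sub>R f x"
      using subspace_scale[OF L f[of x], of c]
      by (intro f_unique) (simp add: scaleR_diff_right)
  qed
  have "f e = 1"
    using subspace_0[OF L] by (intro f_unique) simp
  have K_iff: "x \<in> K \<longleftrightarrow> f x \<ge> 0" for x
  proof
    assume "x \<in> K"
    \<comment> \<open>This sum equals \<open>f x\<close> times \<open>e\<close>; the subtracted
      vector is in \<open>L\<close>, so its negative is in \<open>K\<close>.\<close>
    then have "x + - (x - f x *\<^sub>R e) \<in> K"
      using f[of x] by (intro Kadd) (simp_all add: L_def)
    then show "f x \<ge> 0"
      using neg_mult_e[of "f x"] by fastforce
  next
    assume "f x \<ge> 0"
    then have "(x - f x *\<^sub>R e) + f x *\<^sub>R e \<in> K"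
      using f[of x] e(1) by (intro Kadd Kscale) (simp_all add: L_def)
    then show "x \<in> K"
      by simp
  qed
  have "continuous_on UNIV f"
  proof (rule continuous_on_if_closed_levels)
    fix a
    \<comment> \<open>Because \<open>f e = 1\<close>, subtracting \<open>a e\<close> lowers
      \<open>f\<close> by \<open>a\<close>, so each level set is the preimage of \<open>K\<close>
      under a translation or a point reflection.\<close>
    have "{x. f x \<ge> a} = (\<lambda>x. x - a *\<^sub>R e) -` K"
      using \<open>f e = 1\<close> \<open>linear f\<close> by (auto simp: K_iff linear_diff linear_cmul)
    moreover have "{x. f x \<le> a} = (\<lambda>x. a *\<^sub>R e - x) -` K"
      using \<open>f e = 1\<close> \<open>linear f\<close> by (auto simp: K_iff linear_diff linear_cmul)
    ultimately show "closed {x. f x \<ge> a}" "closed {x. f x \<le> a}"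
      by (auto intro!: closed_vimage closed continuous_intros)
  qed
  moreover have "f \<noteq> (\<lambda>_. 0)"
    using \<open>f e = 1\<close> by (metis zero_neq_one)
  moreover have "K = halfspace f"
    by (auto simp: K_iff halfspace_def)
  ultimately show thesis
    using that \<open>linear f\<close> by blast
qed

theorem proposition2p17:
  fixes C :: "'z::locally_convex_space set"
  assumes "convex C" and "positive_cone C" and "0 \<in> C" and "closure C \<noteq> UNIV"
  shows "(\<forall>A\<in>closed_upper_sets C. \<forall>B\<in>closed_upper_sets C. A \<supseteq> B \<or> B \<supseteq> A)
    \<longleftrightarrow> (\<exists>f \<in> dual_cone C - {\<lambda>_. 0}. closure C = halfspace f)"
proof
  assume total: "\<forall>A\<in>closed_upper_sets C. \<forall>B\<in>closed_upper_sets C. A \<supseteq> B \<or> B \<supseteq> A"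
  define K where "K = closure C"
  have add: "K + K \<subseteq> K"
    unfolding K_def using convex_positive_cone_add_subset[OF assms(1,2)] closure_subset
    by (intro closure_add_subset) auto
  have "0 \<in> K"
    using assms(3) closure_subset by (auto simp: K_def)
  \<comment> \<open>The preimage is the translate \<open>x + K\<close>.\<close>
  have translate: "(\<lambda>z. z - x) -` K \<in> closed_upper_sets C" for x
    unfolding closed_upper_sets_iff[OF assms(3)] K_def[symmetric]
  proof
    show "closed ((\<lambda>z. z - x) -` K)"
      unfolding K_def by (intro closed_vimage closed_closure continuous_intros)
    have "a + k - x \<in> K" if "a - x \<in> K" "k \<in> K" for a k
      using set_plus_intro[OF that] add by (auto simp: algebra_simps)
    then show "(\<lambda>z. z - x) -` K + K \<subseteq> (\<lambda>z. z - x) -` K"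
      by (auto simp: set_plus_def)
  qed
  have "x \<in> K \<or> - x \<in> K" for x
  proof -
    \<comment> \<open>Whichever of \<open>x + K\<close> and \<open>K\<close> is the larger contains
      the base point of the other: \<open>x \<in> K\<close> in one case,
      \<open>0 \<in> x + K\<close> in the other.\<close>
    have "(\<lambda>z. z - x) -` K \<subseteq> (\<lambda>z. z - 0) -` K \<or> (\<lambda>z. z - 0) -` K \<subseteq> (\<lambda>z. z - x) -` K"
      using total translate[of x] translate[of 0] by (meson bspec)
    moreover have "x \<in> (\<lambda>z. z - x) -` K" "0 \<in> (\<lambda>z. z - 0) -` K"
      using \<open>0 \<in> K\<close> by simp_all
    ultimately have "x - 0 \<in> K \<or> 0 - x \<in> K"
      by blast
    then show ?thesis
      by simp
  qed
  then obtain f where f: "linear f" "continuous_on UNIV f" "f \<noteq> (\<lambda>_. 0)" "K = halfspace f"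
    using closed_total_cone_is_halfspace[OF closed_closure positive_cone_closure[OF assms(2)]]
      add assms(4) unfolding K_def by blast
  have "C \<subseteq> halfspace f"
    using f(4) closure_subset by (auto simp: K_def)
  then have "f \<in> dual_cone C - {\<lambda>_. 0}"
    using f by (auto simp: dual_cone_def topological_dual_def halfspace_def)
  then show "\<exists>f \<in> dual_cone C - {\<lambda>_. 0}. closure C = halfspace f"
    using f(4) K_def by blast
next
  assume "\<exists>f \<in> dual_cone C - {\<lambda>_. 0}. closure C = halfspace f"
  then obtain f where "linear f" and f: "closure C = halfspace f"
    by (auto simp: dual_cone_def topological_dual_def)
  \<comment> \<open>Membership in \<open>A\<close> passes to every point with an
    \<open>f\<close>-value at least as large, since the difference \<open>z - a\<close> lies in the
    half-space that \<open>A\<close> absorbs.\<close>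
  have up: "z \<in> A" if "A \<in> closed_upper_sets C" "a \<in> A" "f a \<le> f z" for A a z
  proof -
    have "z - a \<in> closure C"
      using that(3) \<open>linear f\<close> by (simp add: f halfspace_def linear_diff)
    then have "a + (z - a) \<in> A"
      using that closed_upper_sets_iff[OF assms(3)] by blast
    then show ?thesis
      by simp
  qed
  show "\<forall>A\<in>closed_upper_sets C. \<forall>B\<in>closed_upper_sets C. A \<supseteq> B \<or> B \<supseteq> A"
  proof (intro ballI)
    fix A B
    assume AB: "A \<in> closed_upper_sets C" "B \<in> closed_upper_sets C"
    show "A \<supseteq> B \<or> B \<supseteq> A"
    proof (rule disjCI)
      assume "\<not> B \<supseteq> A"
      then obtain a where "a \<in> A" "a \<notin> B"
        by blast
      \<comment> \<open>Otherwise \<open>up\<close> would carry \<open>b\<close> to \<open>a\<close>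
        inside \<open>B\<close>. So all of \<open>B\<close> lies at or above the level of
        \<open>a\<close>, and \<open>up\<close> puts it into \<open>A\<close>.\<close>
      then have "f a \<le> f b" if "b \<in> B" for b
        using up[OF AB(2) that, of a] by force
      then show "A \<supseteq> B"
        using up[OF AB(1) \<open>a \<in> A\<close>] by blast
    qed
  qed
qed

end
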